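(* For all positive integers $n \ge d \ge 2$ there exists a collection $\mathcal{A} \subset \mathcal{P}([n]^d)$ with $|\mathcal{A}| = |\mathcal{P}([n]^d)|/2$ such that there is no pair $(A,B) \in \mathcal{A} \times \mathcal{A}$ satisfying $A \,\Delta\, B = S^d$ for some non-empty subset $S \subset [n]$ that can be written as a union of at most $\lfloor d/2 \rfloor$ intervals.
   Context: $[n]=\{1,\dots,n\}$; for integers $a \le b$, $[a,b]=\{a,a+1,\dots,b\}$ is called an interval. $\mathcal{P}(X)$ denotes the power set of $X$, $A\,\Delta\, B$ the symmetric difference, and $S^d = S\times\dots\times S \subset [n]^d$ ($d$ factors). *)

theory Defs
  imports Complex_Main "HOL-Library.FuncSet"
begin

text \<open>The d-fold Cartesian power of S: d-tuples are extensional functions on the index set {1..d}.\<close>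

definition cart_power :: "nat set \<Rightarrow> nat \<Rightarrow> (nat \<Rightarrow> nat) set" where
  "cart_power S d = ({1..d} \<rightarrow>\<^sub>E S)"

definition int_interval :: "nat set \<Rightarrow> bool" where
  "int_interval I \<longleftrightarrow> (\<exists>a b. a \<le> b \<and> I = {a..b})"

definition union_of_at_most_intervals :: "nat \<Rightarrow> nat set \<Rightarrow> bool" where
  "union_of_at_most_intervals k S \<longleftrightarrow>
     (\<exists>\<I>. finite \<I> \<and> card \<I> \<le> k \<and> (\<forall>I\<in>\<I>. int_interval I) \<and> S = \<Union>\<I>)"

end

theory Submission
  imports Defs
begin

text \<open>It suffices to find \<open>W \<subseteq> [n]\<^sup>d\<close> meeting \<open>S\<^sup>d\<close> in an odd number of points for every
  admissible \<open>S\<close>: then the sets \<open>A\<close> with \<open>\<bar>A \<inter> W\<bar>\<close> even form the required family. Choosing for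
  every non-empty \<open>T\<close> with at most \<open>d\<close> elements a tuple with image \<open>T\<close> shows that every polynomial
  of degree at most \<open>d\<close> over the two-element field, without constant term, in the indicator
  variables \<open>x\<^sub>i\<close> of \<open>S\<close> is of the form \<open>S \<mapsto> \<bar>W \<inter> S\<^sup>d\<bar> mod 2\<close>.
  The maximal intervals of \<open>S\<close> correspond to their left endpoints, detected by the quadratic
  polynomials \<open>y\<^sub>i = x\<^sub>i (1 - x\<^sub>i\<^sub>-\<^sub>1)\<close>. The sum of the elementary symmetric polynomials
  \<open>e\<^sub>1, \<dots>, e\<^sub>k\<close> in the \<open>y\<^sub>i\<close>, where \<open>k = \<lfloor>d/2\<rfloor>\<close>, has degree at most \<open>2k \<le> d\<close>, and it counts the
  non-empty sets of at most \<open>k\<close> left endpoints. If \<open>S\<close> has \<open>m\<close> left endpoints with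
  \<open>1 \<le> m \<le> k\<close>, this number is \<open>2\<^sup>m - 1\<close>, which is odd.\<close>

section \<open>Polynomials over the two-element field\<close>

text \<open>A set \<open>S\<close> stands for the point whose coordinates are its indicator variables, and \<open>\<T>\<close> for
  the set of monomials of the polynomial, each given by its set of variables; a sum of such
  polynomials takes the value 1 where an odd number of the summands hold.\<close>

definition parity_polynomial :: "nat \<Rightarrow> ('a set \<Rightarrow> bool) \<Rightarrow> bool" where
  "parity_polynomial d f \<longleftrightarrow>
     (\<exists>\<T>. finite \<T> \<and> (\<forall>T\<in>\<T>. finite T \<and> card T \<le> d) \<and> (\<forall>S. f S \<longleftrightarrow> odd (card (\<T> \<inter> Pow S))))"

lemma parity_polynomialI:
  assumes "finite \<T>" and "\<And>T. T \<in> \<T> \<Longrightarrow> finite T" and "\<And>T. T \<in> \<T> \<Longrightarrow> card T \<le> d"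
    and "\<And>S. f S \<longleftrightarrow> odd (card (\<T> \<inter> Pow S))"
  shows "parity_polynomial d f"
  using assms unfolding parity_polynomial_def by blast

lemma parity_polynomialE:
  assumes "parity_polynomial d f"
  obtains \<T> where "finite \<T>" and "\<And>T. T \<in> \<T> \<Longrightarrow> finite T" and "\<And>T. T \<in> \<T> \<Longrightarrow> card T \<le> d"
    and "\<And>S. f S \<longleftrightarrow> odd (card (\<T> \<inter> Pow S))"
  using assms unfolding parity_polynomial_def by blast

lemma parity_polynomial_mono:
  "parity_polynomial d f \<Longrightarrow> d \<le> e \<Longrightarrow> parity_polynomial e f"
  unfolding parity_polynomial_def by (meson order_trans)

lemma parity_polynomial_const: "parity_polynomial d (\<lambda>_. c)"
  by (rule parity_polynomialI[of "if c then {{}} else {}"]) (auto split: if_splits)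

lemma parity_polynomial_mem: "parity_polynomial 1 (\<lambda>S. a \<in> S)"
proof (rule parity_polynomialI[of "{{a}}"])
  show "a \<in> S \<longleftrightarrow> odd (card ({{a}} \<inter> Pow S))" for S
    by (cases "a \<in> S") auto
qed auto

lemma even_card_fibers:
  assumes "finite X"
  shows "even (card {y \<in> h ` X. odd (card {x \<in> X. h x = y})}) \<longleftrightarrow> even (card X)"
proof -
  have "card X = (\<Sum>y\<in>h ` X. card {x \<in> X. h x = y})"
    using sum.image_gen[OF assms, of "\<lambda>_. 1 :: nat" h] by simp
  then show ?thesis
    using assms by (simp add: even_sum_iff)
qed

text \<open>Equal monomials cancel in pairs.\<close>

lemma parity_polynomial_monomials:
  assumes "finite X" and "\<And>p. p \<in> X \<Longrightarrow> finite (h p)" and "\<And>p. p \<in> X \<Longrightarrow> card (h p) \<le> d"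
  shows "parity_polynomial d (\<lambda>S. odd (card {p \<in> X. h p \<subseteq> S}))"
proof (rule parity_polynomialI)
  let ?\<T> = "{T \<in> h ` X. odd (card {p \<in> X. h p = T})}"
  show "finite ?\<T>"
    using assms(1) by simp
  show "finite T" and "card T \<le> d" if "T \<in> ?\<T>" for T
    using that assms(2,3) by auto
  show "odd (card {p \<in> X. h p \<subseteq> S}) \<longleftrightarrow> odd (card (?\<T> \<inter> Pow S))" for S
  proof -
    let ?Y = "{p \<in> X. h p \<subseteq> S}"
    have "h ` ?Y = h ` X \<inter> Pow S" by auto
    moreover have "{p \<in> ?Y. h p = T} = {p \<in> X. h p = T}" if "T \<subseteq> S" for T
      using that by auto
    ultimately have "?\<T> \<inter> Pow S = {T \<in> h ` ?Y. odd (card {p \<in> ?Y. h p = T})}" by auto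
    then show ?thesis
      using even_card_fibers[of ?Y h] assms(1) by simp
  qed
qed

lemma parity_polynomial_sum:
  assumes "finite J" and "\<And>j. j \<in> J \<Longrightarrow> parity_polynomial d (f j)"
  shows "parity_polynomial d (\<lambda>S. odd (card {j \<in> J. f j S}))"
proof -
  obtain \<T> where \<T>: "\<And>j. j \<in> J \<Longrightarrow> finite (\<T> j)"
      "\<And>j T. j \<in> J \<Longrightarrow> T \<in> \<T> j \<Longrightarrow> finite T \<and> card T \<le> d"
      "\<And>j S. j \<in> J \<Longrightarrow> f j S \<longleftrightarrow> odd (card (\<T> j \<inter> Pow S))"
    using assms(2) unfolding parity_polynomial_def by metis
  have "odd (card {j \<in> J. f j S}) \<longleftrightarrow> odd (card {p \<in> Sigma J \<T>. snd p \<subseteq> S})" for S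
  proof -
    have "{p \<in> Sigma J \<T>. snd p \<subseteq> S} = (SIGMA j:J. \<T> j \<inter> Pow S)" by auto
    then have "card {p \<in> Sigma J \<T>. snd p \<subseteq> S} = (\<Sum>j\<in>J. card (\<T> j \<inter> Pow S))"
      using assms(1) \<T>(1) by simp
    moreover have "{j \<in> J. f j S} = {j \<in> J. odd (card (\<T> j \<inter> Pow S))}"
      using \<T>(3) by blast
    ultimately show ?thesis
      using assms(1) by (simp add: even_sum_iff)
  qed
  moreover have "parity_polynomial d (\<lambda>S. odd (card {p \<in> Sigma J \<T>. snd p \<subseteq> S}))"
    using assms(1) \<T>(1,2) by (intro parity_polynomial_monomials) auto
  ultimately show ?thesis by simp
qed

lemma parity_polynomial_not:
  assumes "parity_polynomial d f"
  shows "parity_polynomial d (\<lambda>S. \<not> f S)"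
proof -
  have "parity_polynomial d (\<lambda>S. b \<longrightarrow> f S)" for b
    using assms parity_polynomial_const[of d True] by (cases b) simp_all
  then have "parity_polynomial d (\<lambda>S. odd (card {b \<in> UNIV. b \<longrightarrow> f S}))"
    by (intro parity_polynomial_sum) auto
  moreover have "{b \<in> UNIV. b \<longrightarrow> f S} = (if f S then UNIV else {False})" for S
    by auto
  then have "odd (card {b \<in> UNIV. b \<longrightarrow> f S}) \<longleftrightarrow> \<not> f S" for S
    by (simp only:) simp
  ultimately show ?thesis by simp
qed

lemma parity_polynomial_conj:
  assumes "parity_polynomial d f" and "parity_polynomial e g"
  shows "parity_polynomial (d + e) (\<lambda>S. f S \<and> g S)"
proof -
  from assms(1) obtain \<T> where \<T>: "finite \<T>" "\<And>T. T \<in> \<T> \<Longrightarrow> finite T"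
      "\<And>T. T \<in> \<T> \<Longrightarrow> card T \<le> d" "\<And>S. f S \<longleftrightarrow> odd (card (\<T> \<inter> Pow S))"
    by (rule parity_polynomialE) blast
  from assms(2) obtain \<V> where \<V>: "finite \<V>" "\<And>V. V \<in> \<V> \<Longrightarrow> finite V"
      "\<And>V. V \<in> \<V> \<Longrightarrow> card V \<le> e" "\<And>S. g S \<longleftrightarrow> odd (card (\<V> \<inter> Pow S))"
    by (rule parity_polynomialE) blast
  let ?h = "\<lambda>p. fst p \<union> snd p"
  have "{p \<in> \<T> \<times> \<V>. ?h p \<subseteq> S} = (\<T> \<inter> Pow S) \<times> (\<V> \<inter> Pow S)" for S
    by auto
  then have "f S \<and> g S \<longleftrightarrow> odd (card {p \<in> \<T> \<times> \<V>. ?h p \<subseteq> S})" for S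
    by (simp add: \<T>(4) \<V>(4) card_cartesian_product)
  moreover have "card (?h p) \<le> d + e" if "p \<in> \<T> \<times> \<V>" for p
  proof -
    have "card (fst p \<union> snd p) \<le> card (fst p) + card (snd p)" by (rule card_Un_le)
    also have "\<dots> \<le> d + e" using that \<T>(3) \<V>(3) by (intro add_mono) auto
    finally show ?thesis .
  qed
  then have "parity_polynomial (d + e) (\<lambda>S. odd (card {p \<in> \<T> \<times> \<V>. ?h p \<subseteq> S}))"
    using \<T>(1,2) \<V>(1,2) by (intro parity_polynomial_monomials) auto
  ultimately show ?thesis by simp
qed

lemma parity_polynomial_Ball:
  assumes "finite J" and "\<And>j. j \<in> J \<Longrightarrow> parity_polynomial d (f j)"
  shows "parity_polynomial (d * card J) (\<lambda>S. \<forall>j\<in>J. f j S)"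
  using assms
proof (induction J)
  case empty
  then show ?case by (simp add: parity_polynomial_const)
next
  case (insert j J)
  then have "parity_polynomial (d + d * card J) (\<lambda>S. f j S \<and> (\<forall>i\<in>J. f i S))"
    by (intro parity_polynomial_conj) auto
  then show ?case using insert.hyps by simp
qed

section \<open>Testing whether a small set is non-empty\<close>

definition small_subsets :: "nat \<Rightarrow> 'a set \<Rightarrow> 'a set set" where
  "small_subsets k A = {B. B \<subseteq> A \<and> B \<noteq> {} \<and> card B \<le> k}"

lemma small_subsets_empty: "small_subsets k {} = {}"
  by (auto simp: small_subsets_def)

lemma odd_card_small_subsets:
  assumes "finite A" and "A \<noteq> {}" and "card A \<le> k"
  shows "odd (card (small_subsets k A))"
proof -
  have "card B \<le> k" if "B \<subseteq> A" for B
    using card_mono[OF assms(1) that] assms(3) by simp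
  then have "small_subsets k A = Pow A - {{}}"
    by (auto simp: small_subsets_def)
  then have "card (small_subsets k A) = 2 ^ card A - 1"
    using assms(1) by (simp add: card_Pow)
  then show ?thesis using assms(1,2) by simp
qed

lemma parity_polynomial_small_subsets:
  assumes "finite I" and "\<And>i. i \<in> I \<Longrightarrow> parity_polynomial d (\<lambda>S. i \<in> L S)"
  shows "parity_polynomial (d * k) (\<lambda>S. odd (card (small_subsets k (I \<inter> L S))))"
proof -
  have "parity_polynomial (d * k) (\<lambda>S. \<forall>i\<in>J. i \<in> L S)" if "J \<in> small_subsets k I" for J
  proof (rule parity_polynomial_mono)
    show "parity_polynomial (d * card J) (\<lambda>S. \<forall>i\<in>J. i \<in> L S)"
      using that assms by (intro parity_polynomial_Ball) (auto simp: small_subsets_def finite_subset)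
    show "d * card J \<le> d * k"
      using that by (simp add: small_subsets_def)
  qed
  moreover have "finite (small_subsets k I)"
    using assms(1) by (simp add: small_subsets_def)
  ultimately have "parity_polynomial (d * k)
      (\<lambda>S. odd (card {J \<in> small_subsets k I. \<forall>i\<in>J. i \<in> L S}))"
    by (intro parity_polynomial_sum)
  moreover have "{J \<in> small_subsets k I. \<forall>i\<in>J. i \<in> L S} = small_subsets k (I \<inter> L S)" for S
    by (auto simp: small_subsets_def)
  ultimately show ?thesis by simp
qed

section \<open>Left endpoints of unions of intervals\<close>

definition left_endpoints :: "nat set \<Rightarrow> nat set" where
  "left_endpoints S = S - Suc ` S"

lemma left_endpoints_subset: "left_endpoints S \<subseteq> S"
  by (auto simp: left_endpoints_def)

lemma left_endpoints_nonempty: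
  assumes "S \<noteq> {}"
  shows "left_endpoints S \<noteq> {}"
proof -
  have "(LEAST i. i \<in> S) \<in> S"
    using assms by (auto intro: LeastI)
  moreover have "(LEAST i. i \<in> S) \<noteq> Suc j" if "j \<in> S" for j
    using Least_le[of "\<lambda>i. i \<in> S", OF that] by simp
  ultimately show ?thesis by (auto simp: left_endpoints_def)
qed

lemma card_left_endpoints_le:
  assumes "union_of_at_most_intervals k S"
  shows "card (left_endpoints S) \<le> k"
proof -
  obtain \<I> where \<I>: "finite \<I>" "card \<I> \<le> k" "\<And>I. I \<in> \<I> \<Longrightarrow> int_interval I" "S = \<Union>\<I>"
    using assms unfolding union_of_at_most_intervals_def by blast
  have "left_endpoints S \<subseteq> Min ` \<I>"
  proof
    fix i assume "i \<in> left_endpoints S"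
    then have i: "i \<in> S" "i \<notin> Suc ` S" by (auto simp: left_endpoints_def)
    from i(1) obtain I where "I \<in> \<I>" "i \<in> I" using \<I>(4) by blast
    moreover from this(1) obtain a b where "I = {a..b}"
      using \<I>(3) unfolding int_interval_def by blast
    ultimately have ab: "{a..b} \<in> \<I>" "a \<le> i" "i \<le> b" by simp_all
    have "i = a"
    proof (rule ccontr)
      assume "i \<noteq> a"
      then have "i = Suc (i - 1)" "i - 1 \<in> {a..b}" using ab by auto
      then show False using i(2) ab(1) \<I>(4) by blast
    qed
    then have "Min {a..b} = i" using ab by (auto intro: Min_eqI)
    then show "i \<in> Min ` \<I>" using ab(1) by blast
  qed
  then have "card (left_endpoints S) \<le> card \<I>"
    using \<I>(1) by (rule surj_card_le[rotated])
  then show ?thesis using \<I>(2) by simp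
qed

lemma union_of_at_most_intervals_singleton:
  assumes "k \<ge> 1"
  shows "union_of_at_most_intervals k {a}"
proof -
  have "int_interval {a}"
    unfolding int_interval_def by (intro exI[of _ a]) simp
  then show ?thesis
    using assms unfolding union_of_at_most_intervals_def by (intro exI[of _ "{{a}}"]) simp
qed

lemma parity_polynomial_left_endpoints: "parity_polynomial 2 (\<lambda>S. i \<in> left_endpoints S)"
proof -
  have "parity_polynomial 1 (\<lambda>S. i \<in> Suc ` S)"
  proof (cases i)
    case 0
    then show ?thesis using parity_polynomial_const[of 1 False] by simp
  next
    case (Suc j)
    then show ?thesis using parity_polynomial_mem[of j] by (simp add: inj_image_mem_iff)
  qed
  then have "parity_polynomial (1 + 1) (\<lambda>S. i \<in> S \<and> i \<notin> Suc ` S)"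
    by (intro parity_polynomial_conj parity_polynomial_mem parity_polynomial_not)
  then show ?thesis by (simp add: left_endpoints_def numeral_2_eq_2)
qed

section \<open>Counting tuples modulo two\<close>

lemma mem_cart_power_iff:
  "w \<in> cart_power S d \<longleftrightarrow> w \<in> extensional {1..d} \<and> w ` {1..d} \<subseteq> S"
  by (auto simp: cart_power_def PiE_def)

lemma finite_cart_power: "finite S \<Longrightarrow> finite (cart_power S d)"
  by (simp add: cart_power_def finite_PiE)

lemma cart_power_mono: "S \<subseteq> T \<Longrightarrow> cart_power S d \<subseteq> cart_power T d"
  by (auto simp: cart_power_def)

lemma ex_tuple_with_image:
  assumes "finite T" and "T \<noteq> {}" and "card T \<le> d"
  shows "\<exists>w. w \<in> extensional {1..d} \<and> w ` {1..d} = T"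
proof -
  have "\<exists>g. g ` {1..d} = T"
    using assms by (simp flip: inj_on_iff_surj add: inj_on_iff_card_le)
  then obtain g where "g ` {1..d} = T" by blast
  then have "restrict g {1..d} \<in> extensional {1..d} \<and> restrict g {1..d} ` {1..d} = T"
    by simp
  then show ?thesis by blast
qed

lemma ex_tuples_with_parity:
  assumes "parity_polynomial d f" and "\<not> f {}"
  shows "\<exists>W. \<forall>S. odd (card (W \<inter> cart_power S d)) \<longleftrightarrow> f S"
proof -
  from assms(1) obtain \<T> where \<T>: "finite \<T>" "\<And>T. T \<in> \<T> \<Longrightarrow> finite T"
      "\<And>T. T \<in> \<T> \<Longrightarrow> card T \<le> d" "\<And>S. f S \<longleftrightarrow> odd (card (\<T> \<inter> Pow S))"
    by (rule parity_polynomialE) blast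
  have "{} \<notin> \<T>"
    using assms(2) \<T>(4)[of "{}"] by auto
  then have "\<exists>w. w \<in> extensional {1..d} \<and> w ` {1..d} = T" if "T \<in> \<T>" for T
    using that \<T>(2,3) by (intro ex_tuple_with_image) auto
  then obtain tuple where
    tuple: "\<And>T. T \<in> \<T> \<Longrightarrow> tuple T \<in> extensional {1..d}" "\<And>T. T \<in> \<T> \<Longrightarrow> tuple T ` {1..d} = T"
    by metis
  have "inj_on tuple \<T>"
    using tuple(2) by (intro inj_on_inverseI[where g = "\<lambda>w. w ` {1..d}"])
  have "card (tuple ` \<T> \<inter> cart_power S d) = card (\<T> \<inter> Pow S)" for S
  proof -
    have "tuple T \<in> cart_power S d \<longleftrightarrow> T \<subseteq> S" if "T \<in> \<T>" for T
      using that tuple by (simp add: mem_cart_power_iff)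
    then have "tuple ` \<T> \<inter> cart_power S d = tuple ` (\<T> \<inter> Pow S)" by blast
    then show ?thesis
      using \<open>inj_on tuple \<T>\<close> by (simp add: card_image inj_on_Int)
  qed
  then show ?thesis using \<T>(4) by (intro exI[of _ "tuple ` \<T>"]) simp
qed

lemma ex_tuples_odd_on_interval_unions:
  assumes "finite N"
  obtains W where "W \<subseteq> cart_power N d"
    and "\<And>S. S \<subseteq> N \<Longrightarrow> S \<noteq> {} \<Longrightarrow> union_of_at_most_intervals (d div 2) S \<Longrightarrow>
           odd (card (W \<inter> cart_power S d))"
proof -
  let ?f = "\<lambda>S. odd (card (small_subsets (d div 2) (N \<inter> left_endpoints S)))"
  have "parity_polynomial (2 * (d div 2)) ?f"
    using assms by (intro parity_polynomial_small_subsets parity_polynomial_left_endpoints)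
  then have "parity_polynomial d ?f"
    by (rule parity_polynomial_mono) simp
  moreover have "\<not> ?f {}"
    by (simp add: small_subsets_empty left_endpoints_def)
  ultimately obtain W where W: "\<And>S. odd (card (W \<inter> cart_power S d)) \<longleftrightarrow> ?f S"
    using ex_tuples_with_parity by metis
  show thesis
  proof
    show "W \<inter> cart_power N d \<subseteq> cart_power N d" by simp
  next
    fix S assume S: "S \<subseteq> N" "S \<noteq> {}" "union_of_at_most_intervals (d div 2) S"
    have "left_endpoints S \<subseteq> N"
      using left_endpoints_subset S(1) by blast
    moreover from this have "odd (card (small_subsets (d div 2) (left_endpoints S)))"
      using assms S by (intro odd_card_small_subsets left_endpoints_nonempty card_left_endpoints_le)
        (auto intro: finite_subset)
    ultimately have "?f S" by (simp add: Int_absorb1)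
    moreover have "W \<inter> cart_power N d \<inter> cart_power S d = W \<inter> cart_power S d"
      using cart_power_mono[OF S(1)] by blast
    ultimately show "odd (card (W \<inter> cart_power N d \<inter> cart_power S d))"
      using W by simp
  qed
qed

section \<open>Sets meeting a given set evenly\<close>

definition evenly_meeting :: "'a set \<Rightarrow> 'a set \<Rightarrow> 'a set set" where
  "evenly_meeting U W = {A \<in> Pow U. even (card (A \<inter> W))}"

lemma even_card_sym_diff:
  assumes "finite A" and "finite B"
  shows "even (card (sym_diff A B)) \<longleftrightarrow> even (card A + card B)"
proof -
  have "card A = card (A - B) + card (A \<inter> B)" "card B = card (B - A) + card (A \<inter> B)"
    using assms card_Int_Diff[of A B] card_Int_Diff[of B A] by (simp_all add: Int_commute)
  moreover have "card (sym_diff A B) = card (A - B) + card (B - A)"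
    using assms by (intro card_Un_disjoint) auto
  ultimately show ?thesis by auto
qed

lemma even_card_sym_diff_Int:
  assumes "finite W"
  shows "even (card (sym_diff A B \<inter> W)) \<longleftrightarrow> even (card (A \<inter> W) + card (B \<inter> W))"
proof -
  have "sym_diff A B \<inter> W = sym_diff (A \<inter> W) (B \<inter> W)" by blast
  then show ?thesis using assms by (simp add: even_card_sym_diff)
qed

lemma card_evenly_meeting:
  assumes "finite U" and "W \<subseteq> U" and "W \<noteq> {}"
  shows "2 * card (evenly_meeting U W) = card (Pow U)"
proof -
  obtain w where w: "w \<in> W" using assms by auto
  let ?toggle = "\<lambda>A. sym_diff A {w}"
  have "finite W" using assms finite_subset by auto
  then have "even (card (?toggle A \<inter> W)) \<longleftrightarrow> odd (card (A \<inter> W))" for A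
    using w by (simp add: even_card_sym_diff_Int)
  moreover have "?toggle A \<in> Pow U" if "A \<in> Pow U" for A
    using that w assms(2) by auto
  ultimately have "bij_betw ?toggle (evenly_meeting U W) (Pow U - evenly_meeting U W)"
    by (intro bij_betw_byWitness[where f' = ?toggle]) (auto simp: evenly_meeting_def)
  then have "card (evenly_meeting U W) = card (Pow U - evenly_meeting U W)"
    by (rule bij_betw_same_card)
  moreover have "Pow U \<inter> evenly_meeting U W = evenly_meeting U W"
    by (auto simp: evenly_meeting_def)
  then have "card (Pow U) = card (evenly_meeting U W) + card (Pow U - evenly_meeting U W)"
    using assms(1) card_Int_Diff[of "Pow U" "evenly_meeting U W"] by simp
  ultimately show ?thesis by simp
qed

theorem theorem1p3:
  fixes n d :: nat
  assumes "d \<ge> 2" and "n \<ge> d"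
  shows "\<exists>\<A>. \<A> \<subseteq> Pow (cart_power {1..n} d) \<and>
           real (card \<A>) = real (card (Pow (cart_power {1..n} d))) / 2 \<and>
           \<not> (\<exists>(A, B) \<in> \<A> \<times> \<A>. \<exists>S. S \<noteq> {} \<and> S \<subseteq> {1..n} \<and>
                 union_of_at_most_intervals (d div 2) S \<and>
                 sym_diff A B = cart_power S d)"
proof -
  let ?U = "cart_power {1..n} d"
  have "finite ?U" by (simp add: finite_cart_power)
  obtain W where "W \<subseteq> ?U"
    and odd_W: "\<And>S. S \<subseteq> {1..n} \<Longrightarrow> S \<noteq> {} \<Longrightarrow> union_of_at_most_intervals (d div 2) S \<Longrightarrow>
                  odd (card (W \<inter> cart_power S d))"
    using ex_tuples_odd_on_interval_unions[OF finite_atLeastAtMost] by blast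
  have "finite W" using \<open>W \<subseteq> ?U\<close> \<open>finite ?U\<close> by (rule finite_subset)
  have "W \<noteq> {}"
    using odd_W[of "{1}"] union_of_at_most_intervals_singleton[of "d div 2" 1] assms by auto
  then have "2 * card (evenly_meeting ?U W) = card (Pow ?U)"
    using \<open>finite ?U\<close> \<open>W \<subseteq> ?U\<close> by (intro card_evenly_meeting)
  then have "real (card (evenly_meeting ?U W)) = real (card (Pow ?U)) / 2" by linarith
  moreover have "sym_diff A B \<noteq> cart_power S d"
    if "A \<in> evenly_meeting ?U W" "B \<in> evenly_meeting ?U W" "S \<noteq> {}" "S \<subseteq> {1..n}"
      "union_of_at_most_intervals (d div 2) S" for A B S
    using that odd_W[of S] even_card_sym_diff_Int[OF \<open>finite W\<close>, of A B]
    by (auto simp: evenly_meeting_def Int_commute)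
  moreover have "evenly_meeting ?U W \<subseteq> Pow ?U" by (auto simp: evenly_meeting_def)
  ultimately show ?thesis by (intro exI[of _ "evenly_meeting ?U W"]) blast
qed

end
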